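(* (i) There is an integer $M$ such that every integer $\rho\ge M$ is the repeat factor of some independent Stanley sequence. (ii) Every triadic number $\alpha\ge 1$ is the scaling factor of some independent Stanley sequence.
   Context: A set of integers is 3-free if no three distinct elements form an arithmetic progression. Given a finite 3-free set $A$ of nonnegative integers $0=a_0<a_1<\cdots<a_t$, the Stanley sequence $S(A)=\{a_n\}_{n\ge 0}$ is the infinite sequence extending $A$ in which, for each $n>t$ recursively, $a_n$ is the smallest integer greater than $a_{n-1}$ such that $\{a_0,a_1,\ldots,a_n\}$ is 3-free. A Stanley sequence $S(A)=\{a_n\}$ is independent if there exist integer constants $\lambda$ and $\kappa\ge 0$ such that for all $k\ge\kappa$: (1) $a_{2^k+i}=a_{2^k}+a_i$ whenever $0\le i<2^k$, and (2) $a_{2^k}=2a_{2^k-1}+1-\lambda$. In that case $\lambda(A)$ denotes this $\lambda$ (which is unique), and $\kappa(A)$ denotes the minimum such $\kappa$. These conditions imply $a_{2^{k+1}}=3a_{2^k}$ for $k\ge\kappa(A)$, so there is a positive number $\alpha=\alpha(A)$, called the scaling factor of $S(A)$, with $a_{2^k}=\alpha\cdot 3^k$ for all $k\ge\kappa(A)$. The repeat factor of $S(A)$ is $\rho(A):=a_{2^{\kappa(A)}}=\alpha(A)\cdot 3^{\kappa(A)}$. A triadic number is a rational number whose denominator, in lowest terms, is a power of $3$ (including $3^0=1$). *)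

theory Defs
  imports Complex_Main
begin

text \<open>
  All the sets and sequences involved consist of nonnegative integers, so they are rendered over
  \<^typ>\<open>nat\<close>. Three distinct elements form an arithmetic progression iff, listed in increasing
  order, the middle one is the average of the outer two.
\<close>

definition three_free :: "nat set \<Rightarrow> bool" where
  "three_free S \<longleftrightarrow> \<not> (\<exists>x\<in>S. \<exists>y\<in>S. \<exists>z\<in>S. x < y \<and> y < z \<and> x + z = 2 * y)"

definition stanley_base :: "nat set \<Rightarrow> bool" where
  "stanley_base A \<longleftrightarrow> finite A \<and> 0 \<in> A \<and> three_free A"

text \<open>
  The terms with index below \<^term>\<open>card A\<close> (which is \<open>t + 1\<close> for a base \<open>0 = a\<^sub>0 < \<dots> < a\<^sub>t\<close>) list
  \<open>A\<close> in increasing order. The values are meaningful only if \<^term>\<open>stanley_base A\<close> holds.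
\<close>

fun stanley_seq :: "nat set \<Rightarrow> nat \<Rightarrow> nat" where
  "stanley_seq A 0 = sorted_list_of_set A ! 0"
| "stanley_seq A (Suc n) =
    (if Suc n < card A then sorted_list_of_set A ! Suc n
     else LEAST m. stanley_seq A n < m \<and> three_free (insert m (stanley_seq A ` {..n})))"

definition independent_with :: "nat set \<Rightarrow> int \<Rightarrow> nat \<Rightarrow> bool" where
  "independent_with A l \<kappa> \<longleftrightarrow> (\<forall>k\<ge>\<kappa>.
     (\<forall>i<2 ^ k. stanley_seq A (2 ^ k + i) = stanley_seq A (2 ^ k) + stanley_seq A i) \<and>
     int (stanley_seq A (2 ^ k)) = 2 * int (stanley_seq A (2 ^ k - 1)) + 1 - l)"

definition independent_stanley :: "nat set \<Rightarrow> bool" where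
  "independent_stanley A \<longleftrightarrow> stanley_base A \<and> (\<exists>l \<kappa>. independent_with A l \<kappa>)"

text \<open>
  The constants below are meaningful only if \<^term>\<open>independent_stanley A\<close> holds; the \<open>l\<close> in
  \<^term>\<open>independent_with A l \<kappa>\<close> is then the same for every admissible \<open>\<kappa>\<close>.
\<close>

definition stanley_kappa :: "nat set \<Rightarrow> nat" where
  "stanley_kappa A = (LEAST \<kappa>. \<exists>l. independent_with A l \<kappa>)"

definition scaling_factor :: "nat set \<Rightarrow> rat" where
  "scaling_factor A = (THE \<alpha>. \<alpha> > 0 \<and>
     (\<forall>k\<ge>stanley_kappa A. of_nat (stanley_seq A (2 ^ k)) = \<alpha> * 3 ^ k))"

definition repeat_factor :: "nat set \<Rightarrow> nat" where
  "repeat_factor A = stanley_seq A (2 ^ stanley_kappa A)"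

definition triadic :: "rat \<Rightarrow> bool" where
  "triadic \<alpha> \<longleftrightarrow> (\<exists>j. snd (quotient_of \<alpha>) = 3 ^ j)"

end

theory Submission
  imports Defs
begin

text \<open>
  Call \<open>X \<subseteq> [0, N)\<close> modular if it is 3-free modulo \<open>N\<close> and its three-term progressions cover, modulo
  \<open>N\<close>, everything outside \<open>X\<close>. Writing \<open>T\<close> for the numbers with ternary digits 0 and 1, the set
  \<open>X + N T\<close> is then the Stanley sequence of \<open>X\<close>, because every natural number is \<open>2 t - s\<close> with
  \<open>s \<le> t\<close> in \<open>T\<close>. If \<open>X\<close> has \<open>2^\<kappa>\<close> elements, the sequence is independent with \<open>a\<^bsub>2^\<kappa>\<^esub> = N\<close>.

  Start from \<open>X\<close> modular for \<open>N\<close>, thicken it to \<open>Y = X + N (T \<inter> [0, 3^k))\<close>, which is modular for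
  \<open>P = 3^k N\<close> and whose differences \<open>2 z - y\<close> fill an interval of length about \<open>3 P / 2\<close> ending at
  \<open>P\<close>, and add a copy of \<open>Y\<close> shifted by some \<open>d \<ge> 2 P\<close>. As long as \<open>d\<close> is at most about \<open>5 P / 2\<close>,
  the progressions with one term in each copy wrap around modulo \<open>d + P\<close> and fill the gap between the
  copies. Hence the modulus \<open>N\<close> can be enlarged to anything between about \<open>3 P\<close> and \<open>7 P / 2\<close> while
  \<open>\<kappa>\<close> grows by \<open>k + 1\<close>. Iterating, for every \<open>c\<close> and all large \<open>\<kappa>\<close> each \<open>R\<close> in
  \<open>[3^\<kappa>, c 3^\<kappa>]\<close> is the modulus of such
  a set with \<open>2^\<kappa>\<close> elements. Moreover \<open>\<kappa>\<close> is minimal for these sequences, since a smaller value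
  would force \<open>a\<^bsub>2^\<kappa>\<^esub> = 3 a\<^bsub>2^(\<kappa> - 1)\<^esub>\<close>, that is, \<open>d + P = 3 d\<close>.
\<close>

section \<open>3-free sets and the numbers with ternary digits 0 and 1\<close>

lemma three_freeD:
  assumes "three_free S" "x \<in> S" "y \<in> S" "z \<in> S" "x < y" "y < z"
  shows "x + z \<noteq> 2 * y"
  using assms unfolding three_free_def by blast

lemma three_free_mono:
  assumes "three_free T" "S \<subseteq> T"
  shows "three_free S"
  using assms unfolding three_free_def by (meson subsetD)

text \<open>Reads the binary digits of \<open>n\<close> in base 3, hence enumerates \<open>T\<close>
  increasingly; \<open>T\<close> is itself the Stanley sequence of \<open>{0}\<close>.\<close>

fun ternary :: "nat \<Rightarrow> nat" where
  "ternary n = (if n = 0 then 0 else 3 * ternary (n div 2) + n mod 2)"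

declare ternary.simps [simp del]

lemma ternary_0 [simp]: "ternary 0 = 0"
  by (simp add: ternary.simps)

lemma ternary_rec: "ternary n = 3 * ternary (n div 2) + n mod 2"
  by (cases "n = 0") (simp_all add: ternary.simps [of n])

lemma ternary_less: "i < j \<Longrightarrow> ternary i < ternary j"
proof (induction j arbitrary: i rule: less_induct)
  case (less j)
  show ?case
  proof (cases "i div 2 < j div 2")
    case True
    then have "ternary (i div 2) < ternary (j div 2)"
      using less by simp
    then show ?thesis
      using ternary_rec [of i] ternary_rec [of j] by linarith
  next
    case False
    then have "i div 2 = j div 2" "i mod 2 < j mod 2"
      using less.prems by presburger+
    then show ?thesis
      using ternary_rec [of i] ternary_rec [of j] by simp
  qed
qed

lemma ternary_pow2_add: "i < 2 ^ k \<Longrightarrow> ternary (2 ^ k + i) = 3 ^ k + ternary i"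
proof (induction k arbitrary: i)
  case 0
  then show ?case by (simp add: ternary.simps)
next
  case (Suc k)
  have "(2 ^ Suc k + i) div 2 = 2 ^ k + i div 2" "(2 ^ Suc k + i) mod 2 = i mod 2"
    by simp_all
  moreover have "ternary (2 ^ k + i div 2) = 3 ^ k + ternary (i div 2)"
    using Suc by simp
  ultimately show ?case
    using ternary_rec [of "2 ^ Suc k + i"] ternary_rec [of i] by simp
qed

text \<open>All digits of \<open>2 ^ k - 1\<close> are 1. This value is what keeps \<open>l\<close>
  in \<open>independent_with\<close> the same for all \<open>k\<close>.\<close>

lemma ternary_pow2_minus_1: "2 * ternary (2 ^ k - 1) + 1 = 3 ^ k"
proof (induction k)
  case 0
  then show ?case by simp
next
  case (Suc k)
  have "ternary (2 ^ Suc k - 1) = 3 ^ k + ternary (2 ^ k - 1)"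
    using ternary_pow2_add [of "2 ^ k - 1" k] by (simp add: mult_2)
  then show ?case
    using Suc by simp
qed

text \<open>The last digits satisfy \<open>r + t = 2 s\<close> modulo 3. For digits 0 and 1 this
  forces all three to be equal, and the remaining digits form a smaller instance.\<close>

lemma ternary_progression:
  "ternary i + ternary k = 2 * ternary j \<Longrightarrow> i = j \<and> k = j"
proof (induction "i + j + k" arbitrary: i j k rule: less_induct)
  case less
  show ?case
  proof (cases "i + j + k = 0")
    case False
    have *: "3 * ternary (i div 2) + i mod 2 + (3 * ternary (k div 2) + k mod 2)
        = 2 * (3 * ternary (j div 2) + j mod 2)"
      using less.prems by (simp only: flip: ternary_rec)
    have arith: "r = s \<and> t = s" if "3 * a + r + (3 * c + t) = 2 * (3 * b + s)" "r < 2" "s < 2" "t < 2"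
      for a b c r s t :: nat
    proof -
      have "(r + t) mod 3 = (3 * a + r + (3 * c + t)) mod 3" by presburger
      also have "\<dots> = (2 * s) mod 3" unfolding that(1) by presburger
      finally show ?thesis
        using that(2-4) by (auto simp: less_2_cases_iff)
    qed
    have m: "i mod 2 = j mod 2" "k mod 2 = j mod 2"
      using arith [OF *] by simp_all
    then have "ternary (i div 2) + ternary (k div 2) = 2 * ternary (j div 2)"
      using * by simp
    moreover have "i div 2 + j div 2 + k div 2 < i + j + k"
      using False by linarith
    ultimately have "i div 2 = j div 2 \<and> k div 2 = j div 2"
      using less.hyps by blast
    then show ?thesis
      using m by (metis div_mult_mod_eq)
  qed simp
qed

text \<open>Digit by digit and without carries: 0 = 2 * 0 - 0, 1 = 2 * 1 - 1, 2 = 2 * 1 - 0.\<close>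

lemma ternary_cover: "\<exists>i j. ternary i \<le> ternary j \<and> u + ternary i = 2 * ternary j"
proof (induction u rule: less_induct)
  case (less u)
  show ?case
  proof (cases "u = 0")
    case True
    then show ?thesis by (intro exI [of _ 0]) simp
  next
    case False
    then obtain i j where ij: "ternary i \<le> ternary j" "u div 3 + ternary i = 2 * ternary j"
      using less [of "u div 3"] by auto
    have e: "ternary (2 * n) = 3 * ternary n" "ternary (2 * n + 1) = 3 * ternary n + 1" for n
      using ternary_rec [of "2 * n"] ternary_rec [of "2 * n + 1"] by simp_all
    obtain q where q: "q = u div 3" by blast
    consider "u = 3 * q" | "u = 3 * q + 1" | "u = 3 * q + 2"
      unfolding q by linarith
    then show ?thesis
    proof cases
      case 1
      then have "ternary (2 * i) \<le> ternary (2 * j) \<and> u + ternary (2 * i) = 2 * ternary (2 * j)"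
        unfolding e using ij [folded q] by simp
      then show ?thesis by blast
    next
      case 2
      then have "ternary (2 * i + 1) \<le> ternary (2 * j + 1) \<and> u + ternary (2 * i + 1) = 2 * ternary (2 * j + 1)"
        unfolding e using ij [folded q] by simp
      then show ?thesis by blast
    next
      case 3
      then have "ternary (2 * i) \<le> ternary (2 * j + 1) \<and> u + ternary (2 * i) = 2 * ternary (2 * j + 1)"
        unfolding e using ij [folded q] by simp
      then show ?thesis by blast
    qed
  qed
qed

section \<open>Modular sets and their Stanley sequences\<close>

text \<open>
  An uncovered \<open>n\<close> above \<open>Max X\<close> would be adjoined greedily, so the progressions that wrap around \<open>N\<close>
  count only for \<open>n < Max X\<close>, the part of \<open>[0, N)\<close> already fixed by the base.
\<close>

definition modular_set :: "nat set \<Rightarrow> nat \<Rightarrow> bool" where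
  "modular_set X N \<longleftrightarrow> finite X \<and> 0 \<in> X \<and> (\<forall>x\<in>X. x < N) \<and>
     (\<forall>x\<in>X. \<forall>y\<in>X. \<forall>z\<in>X. int N dvd int x + int z - 2 * int y \<longrightarrow> x = y \<and> z = y) \<and>
     (\<forall>n<N. n \<notin> X \<longrightarrow> (\<exists>y\<in>X. \<exists>z\<in>X. y < z \<and>
        (n + y = 2 * z \<or> n + N + y = 2 * z \<and> (\<exists>x\<in>X. n < x))))"

lemma modular_setD:
  assumes "modular_set X N"
  shows "finite X" "0 \<in> X" "\<And>x. x \<in> X \<Longrightarrow> x < N"
    and "\<And>x y z. x \<in> X \<Longrightarrow> y \<in> X \<Longrightarrow> z \<in> X \<Longrightarrow>
      int N dvd int x + int z - 2 * int y \<Longrightarrow> x = y \<and> z = y"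
    and "\<And>n. n < N \<Longrightarrow> n \<notin> X \<Longrightarrow> \<exists>y\<in>X. \<exists>z\<in>X. y < z \<and>
        (n + y = 2 * z \<or> n + N + y = 2 * z \<and> (\<exists>x\<in>X. n < x))"
  using assms unfolding modular_set_def by blast+

definition modular_seq :: "nat set \<Rightarrow> nat \<Rightarrow> nat \<Rightarrow> nat" where
  "modular_seq X N i = sorted_list_of_set X ! (i mod card X) + N * ternary (i div card X)"

context
  fixes X :: "nat set" and N :: nat
  assumes X: "modular_set X N"
begin

private lemma fin: "finite X" and zero: "0 \<in> X" and less_N: "x \<in> X \<Longrightarrow> x < N"
  using modular_setD [OF X] by blast+

private lemma card_pos: "card X > 0"
  using fin zero card_gt_0_iff by blast

private lemma N_pos: "N > 0"
  using less_N [OF zero] .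

private lemma nth_in: "i < card X \<Longrightarrow> sorted_list_of_set X ! i \<in> X"
  using fin nth_mem [of i "sorted_list_of_set X"] by simp

private lemma nth_less: "i < j \<Longrightarrow> j < card X \<Longrightarrow>
    sorted_list_of_set X ! i < sorted_list_of_set X ! j"
  using sorted_wrt_nth_less [OF strict_sorted_list_of_set] by simp

private lemma ex_nth: "x \<in> X \<Longrightarrow> \<exists>i<card X. x = sorted_list_of_set X ! i"
  using fin by (metis in_set_conv_nth sorted_list_of_set.length_sorted_key_list_of_set
      sorted_list_of_set.set_sorted_key_list_of_set)

private lemma nth_0: "sorted_list_of_set X ! 0 = 0"
  using ex_nth [OF zero] nth_less card_pos by (metis gr0I less_nat_zero_code)

lemma modular_seq_less_card: "i < card X \<Longrightarrow> modular_seq X N i = sorted_list_of_set X ! i"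
  by (simp add: modular_seq_def)

lemma strict_mono_modular_seq: "strict_mono (modular_seq X N)"
proof (rule strict_monoI)
  fix i j :: nat
  assume ij: "i < j"
  let ?c = "card X"
  show "modular_seq X N i < modular_seq X N j"
  proof (cases "i div ?c = j div ?c")
    case True
    then have "i mod ?c < j mod ?c"
      using ij by (metis div_mult_mod_eq nat_add_left_cancel_less)
    then show ?thesis
      using True nth_less card_pos by (simp add: modular_seq_def)
  next
    case False
    then have "i div ?c < j div ?c"
      using ij by (simp add: div_le_mono le_neq_implies_less less_imp_le_nat)
    then have "ternary (i div ?c) + 1 \<le> ternary (j div ?c)"
      using ternary_less by fastforce
    then have "N * ternary (i div ?c) + N \<le> N * ternary (j div ?c)"
      by (metis add_mult_distrib2 mult.right_neutral mult_le_mono2)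
    moreover have "sorted_list_of_set X ! (i mod ?c) < N"
      using nth_in less_N card_pos by simp
    ultimately show ?thesis
      by (simp add: modular_seq_def)
  qed
qed

lemma range_modular_seq: "range (modular_seq X N) = {x + N * ternary i |x i. x \<in> X}"
proof (intro subset_antisym subsetI)
  fix v
  assume "v \<in> {x + N * ternary i |x i. x \<in> X}"
  then obtain x i where v: "x \<in> X" "v = x + N * ternary i" by blast
  obtain j where j: "j < card X" "x = sorted_list_of_set X ! j"
    using ex_nth [OF v(1)] by blast
  have "v = modular_seq X N (i * card X + j)"
    using j v by (simp add: modular_seq_def)
  then show "v \<in> range (modular_seq X N)" by blast
next
  fix v
  assume "v \<in> range (modular_seq X N)"
  then show "v \<in> {x + N * ternary i |x i. x \<in> X}"
    unfolding modular_seq_def using nth_in card_pos by fastforce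
qed

text \<open>Modulo \<open>N\<close> only the elements of \<open>X\<close> remain, and they coincide.
  Dividing the rest by \<open>N\<close> leaves a progression in \<open>T\<close>, constant by
  \<open>ternary_progression\<close>.\<close>

lemma three_free_range_modular_seq: "three_free (range (modular_seq X N))"
  unfolding three_free_def
proof (rule notI, elim bexE conjE)
  fix u v w
  assume uvw: "u \<in> range (modular_seq X N)" "v \<in> range (modular_seq X N)"
      "w \<in> range (modular_seq X N)" "u < v" "u + w = 2 * v"
  then obtain x y z i j k where
    in_X: "x \<in> X" "y \<in> X" "z \<in> X"
    and eqs: "u = x + N * ternary i" "v = y + N * ternary j" "w = z + N * ternary k"
    unfolding range_modular_seq by blast
  have "int x + int N * int (ternary i) + (int z + int N * int (ternary k))
      = 2 * (int y + int N * int (ternary j))"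
    using uvw(5) unfolding eqs by (metis of_nat_add of_nat_mult of_nat_numeral)
  then have "int x + int z - 2 * int y
      = int N * (2 * int (ternary j) - int (ternary i) - int (ternary k))"
    by (simp add: algebra_simps)
  then have "x = y \<and> z = y"
    using modular_setD(4) [OF X] in_X dvd_triv_left by metis
  then have "N * (ternary i + ternary k) = N * (2 * ternary j)"
    using uvw(5) unfolding eqs by (simp add: algebra_simps)
  then have "ternary i + ternary k = 2 * ternary j"
    using N_pos by (metis mult_cancel1 not_gr_zero)
  then have "i = j"
    using ternary_progression by blast
  then show False
    using \<open>x = y \<and> z = y\<close> uvw(4) eqs by simp
qed

text \<open>Split \<open>v\<close> into residue and quotient modulo \<open>N\<close>. A progression
  of \<open>X\<close> for the residue and one of \<open>T\<close> for the quotient combine into one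
  that ends in \<open>v\<close>.\<close>

lemma modular_seq_covers:
  assumes v: "v \<notin> range (modular_seq X N)" and above: "\<And>x. x \<in> X \<Longrightarrow> x < v"
  obtains y z where "y \<in> range (modular_seq X N)" "z \<in> range (modular_seq X N)"
    "y < z" "v + y = 2 * z"
proof -
  note cover = that
  define n t where "n = v mod N" and "t = v div N"
  have vn: "v = n + N * t" and n: "n < N"
    using N_pos by (simp_all add: n_def t_def)
  \<comment> \<open>\<open>s\<close> is the carry, 1 if the progression in \<open>X\<close> wraps
    around. If \<open>y = z\<close>, strictness comes from \<open>T\<close> instead:
    \<open>t\<close> outside \<open>T\<close> keeps \<open>i\<close> and \<open>j\<close>
    apart.\<close>
  have thesis_if: thesis if "y \<in> X" "z \<in> X" "y \<le> z" "n + N * s + y = 2 * z"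
    "y < z \<or> t \<notin> range ternary" "s \<le> t" for y z s
  proof -
    obtain i j where ij: "ternary i \<le> ternary j" "t - s + ternary i = 2 * ternary j"
      using ternary_cover by blast
    have "s = 0" if "\<not> y < z"
      using that \<open>y \<le> z\<close> \<open>n + N * s + y = 2 * z\<close> less_N [OF \<open>z \<in> X\<close>]
      by (cases s) auto
    then have "y < z \<or> ternary i < ternary j"
      using that(5) ij by (cases "ternary i = ternary j") auto
    moreover have "N * ternary i \<le> N * ternary j"
      using ij by simp
    moreover have "ternary i < ternary j \<Longrightarrow> N * ternary i < N * ternary j"
      using N_pos by simp
    ultimately have "y + N * ternary i < z + N * ternary j"
      using \<open>y \<le> z\<close> by linarith
    moreover have "v + (y + N * ternary i) = 2 * (z + N * ternary j)"
    proof -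
      have "N * t + N * ternary i = N * s + 2 * (N * ternary j)"
        using ij(2) \<open>s \<le> t\<close>
        by (metis add.assoc add_mult_distrib2 le_add_diff_inverse mult.left_commute)
      then show ?thesis
        using that(4) vn by simp
    qed
    ultimately show thesis
      using that(1,2) by (intro cover [of "y + N * ternary i" "z + N * ternary j"])
        (auto simp: range_modular_seq)
  qed
  show thesis
  proof (cases "n \<in> X")
    case True
    then have "t \<notin> range ternary"
      using v vn unfolding range_modular_seq by blast
    then show thesis
      using thesis_if [of n n 0] True by simp
  next
    case False
    then obtain y z where yz: "y \<in> X" "z \<in> X" "y < z"
      "n + y = 2 * z \<or> n + N + y = 2 * z \<and> (\<exists>x\<in>X. n < x)"
      using modular_setD(5) [OF X n] by blast
    show thesis
    proof (cases "n + y = 2 * z")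
      case True
      then show thesis
        using thesis_if [of y z 0] yz by simp
    next
      case False
      then have "n + N + y = 2 * z" "\<exists>x\<in>X. n < x"
        using yz by auto
      \<comment> \<open>With \<open>t = 0\<close> the wraparound clause would put
        \<open>v = n\<close> below an element of \<open>X\<close>.\<close>
      moreover have "t \<noteq> 0"
        using above vn calculation(2) by (metis add.right_neutral mult_0_right not_less_iff_gr_or_eq)
      ultimately show thesis
        using thesis_if [of y z 1] yz by simp
    qed
  qed
qed

lemma stanley_base_modular: "stanley_base X"
proof -
  have "X \<subseteq> range (modular_seq X N)"
    unfolding range_modular_seq using ternary_0 by (smt (verit) add.right_neutral mem_Collect_eq mult_0_right subsetI)
  then show ?thesis
    using three_free_mono [OF three_free_range_modular_seq] fin zero unfolding stanley_base_def by blast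
qed

text \<open>A candidate \<open>m\<close> skipped by the enumeration ends a progression whose other
  terms are below \<open>m\<close>, hence already chosen; so the greedy rule rejects it.\<close>

lemma stanley_seq_eq_modular_seq: "stanley_seq X n = modular_seq X N n"
proof (induction n rule: less_induct)
  case (less n)
  let ?b = "modular_seq X N"
  show ?case
  proof (cases n)
    case 0
    then show ?thesis
      using card_pos modular_seq_less_card by simp
  next
    case (Suc k)
    show ?thesis
    proof (cases "n < card X")
      case True
      then show ?thesis
        using Suc modular_seq_less_card by simp
    next
      case False
      have img: "stanley_seq X ` {..k} = ?b ` {..k}"
        using less Suc by (intro image_cong) auto
      have "(LEAST m. ?b k < m \<and> three_free (insert m (?b ` {..k}))) = ?b n"
      proof (rule Least_equality)
        have "insert (?b n) (?b ` {..k}) \<subseteq> range ?b" by blast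
        then show "?b k < ?b n \<and> three_free (insert (?b n) (?b ` {..k}))"
          using three_free_mono [OF three_free_range_modular_seq] strict_mono_modular_seq Suc by (simp add: strict_mono_less)
      next
        fix m
        assume m: "?b k < m \<and> three_free (insert m (?b ` {..k}))"
        show "?b n \<le> m"
        proof (rule ccontr)
          assume "\<not> ?b n \<le> m"
          then have mn: "m < ?b n" by simp
          have "m \<notin> range ?b"
            using m mn Suc strict_mono_less [OF strict_mono_modular_seq] by auto
          moreover have "x < m" if "x \<in> X" for x
          proof -
            obtain i where i: "i < card X" "x = ?b i"
              using ex_nth [OF \<open>x \<in> X\<close>] modular_seq_less_card by metis
            then have "i \<le> k"
              using False Suc by simp
            then show ?thesis
              using i m strict_mono_modular_seq by (metis le_less_trans strict_mono_less_eq)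
          qed
          ultimately obtain y z where yz: "y \<in> range ?b" "z \<in> range ?b" "y < z" "m + y = 2 * z"
            using modular_seq_covers by blast
          then have "z < m" by linarith
          have "v \<in> ?b ` {..k}" if "v \<in> range ?b" "v < m" for v
          proof -
            obtain i where "v = ?b i" using \<open>v \<in> range ?b\<close> by blast
            moreover have "v < ?b n" using \<open>v < m\<close> mn by linarith
            ultimately show ?thesis
              using Suc strict_mono_less [OF strict_mono_modular_seq] by simp
          qed
          then have "y \<in> ?b ` {..k}" "z \<in> ?b ` {..k}"
            using yz \<open>z < m\<close> by auto
          then show False
            using three_freeD [OF conjunct2 [OF m], of y z m] yz \<open>z < m\<close> by simp
        qed
      qed
      then show ?thesis
        using False Suc less img by simp
    qed
  qed
qed

section \<open>Independence and the least admissible \<kappa>\<close>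

context
  fixes \<kappa> :: nat
  assumes card_X: "card X = 2 ^ \<kappa>"
begin

lemma stanley_seq_pow2_add:
  assumes "\<kappa> \<le> k" "i < 2 ^ k"
  shows "stanley_seq X (2 ^ k + i) = N * 3 ^ (k - \<kappa>) + stanley_seq X i"
proof -
  have p: "(2::nat) ^ k = 2 ^ \<kappa> * 2 ^ (k - \<kappa>)"
    using assms by (simp flip: power_add)
  have "i div 2 ^ \<kappa> < 2 ^ (k - \<kappa>)"
    using assms p by (simp add: less_mult_imp_div_less mult.commute)
  then show ?thesis
    unfolding stanley_seq_eq_modular_seq modular_seq_def card_X p
    by (simp add: ternary_pow2_add add_mult_distrib2)
qed

lemma stanley_seq_pow2:
  assumes "\<kappa> \<le> k"
  shows "stanley_seq X (2 ^ k) = N * 3 ^ (k - \<kappa>)"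
  using stanley_seq_pow2_add [OF assms, of 0] nth_0 by simp

text \<open>The case \<open>k = \<kappa>\<close> dictates \<open>l\<close>. Beyond it,
  \<open>2 * stanley_seq X (2 ^ k - 1)\<close> and \<open>stanley_seq X (2 ^ k)\<close> both grow by
  \<open>N * (3 ^ (k - \<kappa>) - 1)\<close>.\<close>

lemma independent_with_modular:
  "independent_with X (2 * int (stanley_seq X (2 ^ \<kappa> - 1)) + 1 - int N) \<kappa>"
  unfolding independent_with_def
proof (intro allI impI conjI)
  fix k i :: nat
  assume k: "\<kappa> \<le> k"
  show "stanley_seq X (2 ^ k + i) = stanley_seq X (2 ^ k) + stanley_seq X i" if "i < 2 ^ k"
    using stanley_seq_pow2_add [OF k that] stanley_seq_pow2 [OF k] by simp
  define q :: nat where "q = 2 ^ (k - \<kappa>)"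
  have "(2::nat) ^ k = 2 ^ \<kappa> * q" "q > 0"
    using k by (simp_all add: q_def flip: power_add)
  then have e: "(2::nat) ^ k - 1 = (2 ^ \<kappa> - 1) + 2 ^ \<kappa> * (q - 1)"
    by (cases q) auto
  have "modular_seq X N (i + 2 ^ \<kappa> * h) = modular_seq X N i + N * ternary h" if "i < 2 ^ \<kappa>" for i h
    using that by (simp add: modular_seq_def card_X)
  from this [of "2 ^ \<kappa> - 1" "q - 1"]
  have "stanley_seq X (2 ^ k - 1) = stanley_seq X (2 ^ \<kappa> - 1) + N * ternary (q - 1)"
    unfolding stanley_seq_eq_modular_seq e by simp
  then have "2 * stanley_seq X (2 ^ k - 1) + N
      = 2 * stanley_seq X (2 ^ \<kappa> - 1) + N * (2 * ternary (q - 1) + 1)"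
    by (simp add: algebra_simps)
  then have "2 * stanley_seq X (2 ^ k - 1) + N
      = 2 * stanley_seq X (2 ^ \<kappa> - 1) + stanley_seq X (2 ^ k)"
    unfolding q_def ternary_pow2_minus_1 stanley_seq_pow2 [OF k] .
  then show "int (stanley_seq X (2 ^ k)) = 2 * int (stanley_seq X (2 ^ k - 1)) + 1
      - (2 * int (stanley_seq X (2 ^ \<kappa> - 1)) + 1 - int N)"
    by linarith
qed

lemma independent_modular: "independent_stanley X"
  using stanley_base_modular independent_with_modular unfolding independent_stanley_def by blast

lemma stanley_kappa_modular:
  assumes a: "a \<in> X" "card {x \<in> X. x < a} = 2 ^ (\<kappa> - 1)" "3 * a \<noteq> N"
  shows "stanley_kappa X = \<kappa>"
  unfolding stanley_kappa_def
proof (rule Least_equality)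
  show "\<exists>l. independent_with X l \<kappa>"
    using independent_with_modular by blast
next
  fix k
  assume "\<exists>l. independent_with X l k"
  then obtain l where l: "independent_with X l k" by blast
  show "\<kappa> \<le> k"
  proof (rule ccontr)
    assume "\<not> \<kappa> \<le> k"
    then obtain j where j: "\<kappa> = Suc j" "k \<le> j"
      by (metis Suc_pred gr_zeroI less_Suc_eq_le not_le zero_le)
    obtain i where i: "i < card X" "a = sorted_list_of_set X ! i"
      using ex_nth a by blast
    have "{x \<in> X. x < a} = (!) (sorted_list_of_set X) ` {..<i}"
    proof (intro subset_antisym subsetI)
      fix x
      assume "x \<in> {x \<in> X. x < a}"
      then obtain h where "h < card X" "x = sorted_list_of_set X ! h" "x < a"
        using ex_nth by blast
      then show "x \<in> (!) (sorted_list_of_set X) ` {..<i}"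
        using i nth_less by (metis imageI lessThan_iff not_less_iff_gr_or_eq)
    next
      fix x
      assume "x \<in> (!) (sorted_list_of_set X) ` {..<i}"
      then show "x \<in> {x \<in> X. x < a}"
        using i nth_less nth_in by auto
    qed
    moreover have "inj_on ((!) (sorted_list_of_set X)) {..<i}"
      using i by (intro inj_onI) (metis lessThan_iff less_trans nat_neq_iff nth_less)
    ultimately have "i = 2 ^ j"
      using a(2) j by (simp add: card_image)
    then have sa: "stanley_seq X (2 ^ j) = a"
      using i stanley_seq_eq_modular_seq modular_seq_less_card by simp
    have "int (stanley_seq X (2 ^ h)) = 2 * int (stanley_seq X (2 ^ h - 1)) + 1 - l"
      "i < 2 ^ h \<Longrightarrow> stanley_seq X (2 ^ h + i) = stanley_seq X (2 ^ h) + stanley_seq X i"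
      if "k \<le> h" for h i
      using l that unfolding independent_with_def by blast+
    \<comment> \<open>With \<open>b = stanley_seq X (2 ^ j - 1)\<close> these say that
      \<open>a = 2 b + 1 - l\<close> and that the term at \<open>2 ^ \<kappa>\<close> is
      \<open>2 (a + b) + 1 - l\<close>, which is \<open>3 a\<close>.\<close>
    note this(1) [of j] this(1) [of \<kappa>] this(2) [of j "2 ^ j - 1"]
    moreover have "(2::nat) ^ \<kappa> - 1 = 2 ^ j + (2 ^ j - 1)"
      using j by simp
    ultimately have "stanley_seq X (2 ^ \<kappa>) = 3 * a"
      using sa j by simp
    then show False
      using a(3) stanley_seq_pow2 [of \<kappa>] by simp
  qed
qed

end

end

lemma scaling_factorI:
  assumes "\<alpha> > 0" "\<And>k. stanley_kappa A \<le> k \<Longrightarrow> of_nat (stanley_seq A (2 ^ k)) = \<alpha> * 3 ^ k"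
  shows "scaling_factor A = \<alpha>"
  unfolding scaling_factor_def
proof (rule the_equality)
  fix \<beta> :: rat
  assume "\<beta> > 0 \<and> (\<forall>k\<ge>stanley_kappa A. of_nat (stanley_seq A (2 ^ k)) = \<beta> * 3 ^ k)"
  then have "\<beta> * 3 ^ stanley_kappa A = \<alpha> * 3 ^ stanley_kappa A"
    using assms(2) [of "stanley_kappa A"] by simp
  then show "\<beta> = \<alpha>" by simp
qed (use assms in blast)

section \<open>Tripling and stretching the modulus\<close>

text \<open>The multiple of \<open>N\<close> acts as a ternary digit: 0 and 1 are 3-free modulo 3,
  and 2 = 2 * 1 - 0 covers the missing digit.\<close>

lemma modular_set_triple:
  assumes X: "modular_set X N"
  shows "modular_set (X \<union> (+) N ` X) (3 * N)"
  unfolding modular_set_def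
proof (intro conjI ballI allI impI)
  note XD = modular_setD [OF X]
  have N: "N > 0"
    using XD(2,3) by blast
  have repr: "\<exists>a\<in>X. \<exists>e\<in>{0, 1}. int x = int a + int N * e" if "x \<in> X \<union> (+) N ` X" for x
    using that by force
  show "finite (X \<union> (+) N ` X)" "0 \<in> X \<union> (+) N ` X"
    using XD by auto
  show "x < 3 * N" if "x \<in> X \<union> (+) N ` X" for x
    using that XD(3) by fastforce
  fix x y z
  assume "x \<in> X \<union> (+) N ` X" "y \<in> X \<union> (+) N ` X" "z \<in> X \<union> (+) N ` X"
    and dvd: "int (3 * N) dvd int x + int z - 2 * int y"
  then obtain a b c e f g where in_X: "a \<in> X" "b \<in> X" "c \<in> X"
    and digits: "e \<in> {0, 1}" "f \<in> {0, 1}" "g \<in> {0, 1}"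
    and eqs: "int x = int a + int N * e" "int y = int b + int N * f" "int z = int c + int N * g"
    using repr by metis
  have diff: "int x + int z - 2 * int y = int a + int c - 2 * int b + int N * (e + g - 2 * f)"
    unfolding eqs by (simp add: algebra_simps)
  have "int N dvd int a + int c - 2 * int b + int N * (e + g - 2 * f)"
    using dvd diff by (metis dvd_mult_right of_nat_mult)
  then have "int N dvd int a + int c - 2 * int b"
    by (simp add: dvd_add_left_iff)
  then have "a = b" "c = b"
    using XD(4) in_X by blast+
  then have "int N * 3 dvd int N * (e + g - 2 * f)"
    using dvd diff by (simp add: mult.commute)
  then have "3 dvd e + g - 2 * f"
    using N by simp
  then have "e = f" "g = f"
    using digits by auto
  then show "x = y" "z = y"
    using \<open>a = b\<close> \<open>c = b\<close> eqs by simp_all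
next
  note XD = modular_setD [OF X]
  let ?Y = "X \<union> (+) N ` X"
  fix n
  assume n: "n < 3 * N" "n \<notin> ?Y"
  have sub: "x \<in> ?Y" "N + x \<in> ?Y" if "x \<in> X" for x
    using that by auto
  \<comment> \<open>Only the lowest block wraps around modulo \<open>3 * N\<close>, and there
    \<open>N\<close> is an element above \<open>n\<close>.\<close>
  have by_pair: "\<exists>y\<in>?Y. \<exists>z\<in>?Y. y < z \<and>
      (n + y = 2 * z \<or> n + 3 * N + y = 2 * z \<and> (\<exists>x\<in>?Y. n < x))"
    if "u \<in> ?Y" "v \<in> ?Y" "u < v" "n + u = 2 * v \<or> n + 3 * N + u = 2 * v \<and> n < N" for u v
    using that sub(2) [OF XD(2)] by (metis add.right_neutral)
  consider "n < N" | "N \<le> n" "n < 2 * N" | "2 * N \<le> n" by linarith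
  then show "\<exists>y\<in>?Y. \<exists>z\<in>?Y. y < z \<and>
      (n + y = 2 * z \<or> n + 3 * N + y = 2 * z \<and> (\<exists>x\<in>?Y. n < x))"
  proof cases
    case 1
    then obtain y z where "y \<in> X" "z \<in> X" "y < z" "n + y = 2 * z \<or> n + N + y = 2 * z"
      using XD(5) [of n] n by blast
    then show ?thesis
      using by_pair [of y z] by_pair [of y "N + z"] sub 1 by fastforce
  next
    case 2
    then have "n - N \<notin> X"
      using n(2) by (metis UnI2 image_eqI le_add_diff_inverse)
    then obtain y z where "y \<in> X" "z \<in> X" "y < z"
      "n - N + y = 2 * z \<or> n - N + N + y = 2 * z"
      using XD(5) [of "n - N"] 2 by fastforce
    then show ?thesis
      using by_pair [of y z] by_pair [of "N + y" "N + z"] sub 2 by fastforce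
  next
    case 3
    show ?thesis
    proof (cases "n - 2 * N \<in> X")
      case True
      then show ?thesis
        using by_pair [of "n - 2 * N" "N + (n - 2 * N)"] sub [OF True] 3 XD(3) [OF True] n(1)
        by (cases "N = 0") auto
    next
      case False
      moreover have "n - 2 * N < N"
        using 3 n(1) by linarith
      ultimately obtain y z where "y \<in> X" "z \<in> X" "y < z"
        "n - 2 * N + y = 2 * z \<or> n - 2 * N + N + y = 2 * z"
        using XD(5) [of "n - 2 * N"] by blast
      moreover from this have "n + y = 2 * (N + z) \<or> n + (N + y) = 2 * (N + z)"
        using 3 by auto
      moreover from \<open>y < z\<close> have "y < N + z" "N + y < N + z" by simp_all
      ultimately show ?thesis
        using by_pair [OF sub(1) sub(2), of y z] by_pair [OF sub(2) sub(2), of y z] by blast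
    qed
  qed
qed

text \<open>A point \<open>n\<close> of the gap \<open>[N, d)\<close> is
  \<open>2 (d + z) - y\<close> modulo \<open>d + N\<close> once \<open>2 z - y = n + N - d\<close>;
  this is where the range in \<open>full\<close> comes from.\<close>

lemma modular_set_shift:
  assumes Y: "modular_set Y N" and M: "\<And>y. y \<in> Y \<Longrightarrow> y \<le> M"
    and d: "2 * N \<le> d" "N + 2 * M < d" "M < N"
    and full: "\<And>n. 2 * int N - int d \<le> n \<Longrightarrow> n < int N \<Longrightarrow>
      \<exists>y\<in>Y. \<exists>z\<in>Y. n = 2 * int z - int y"
  shows "modular_set (Y \<union> (+) d ` Y) (d + N)"
  unfolding modular_set_def
proof (intro conjI ballI allI impI)
  note YD = modular_setD [OF Y]
  have N: "N > 0"
    using YD(2,3) by blast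
  show "finite (Y \<union> (+) d ` Y)" "0 \<in> Y \<union> (+) d ` Y"
    using YD by auto
  show "x < d + N" if "x \<in> Y \<union> (+) d ` Y" for x
    using that YD(3) by fastforce
  have repr: "\<exists>a\<in>Y. \<exists>e\<in>{0, 1}. int x = int a + int d * e" if "x \<in> Y \<union> (+) d ` Y" for x
    using that by force
  fix x y z
  assume "x \<in> Y \<union> (+) d ` Y" "y \<in> Y \<union> (+) d ` Y" "z \<in> Y \<union> (+) d ` Y"
    and dvd: "int (d + N) dvd int x + int z - 2 * int y"
  then obtain a b c e f g where in_Y: "a \<in> Y" "b \<in> Y" "c \<in> Y"
    and digits: "e \<in> {0, 1}" "f \<in> {0, 1}" "g \<in> {0, 1}"
    and eqs: "int x = int a + int d * e" "int y = int b + int d * f" "int z = int c + int d * g"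
    using repr by metis
  define s where "s = int a + int c - 2 * int b"
  have s_bound: "- 2 * int M \<le> s" "s \<le> 2 * int M"
    using M [OF in_Y(1)] M [OF in_Y(2)] M [OF in_Y(3)] unfolding s_def by linarith+
  have eq_if: "a = b \<and> c = b" if "int N dvd s"
    using YD(4) in_Y that unfolding s_def by blast
  \<comment> \<open>Either value is divisible by \<open>N\<close>, so \<open>a\<close>,
    \<open>b\<close>, \<open>c\<close> would coincide and \<open>s\<close> would be 0.\<close>
  have s_ne: "s \<noteq> int N" "s \<noteq> - int N"
    using eq_if N unfolding s_def by fastforce+
  obtain q where q: "int x + int z - 2 * int y = int (d + N) * q"
    using dvd by (elim dvdE)
  have diff: "int x + int z - 2 * int y = s + int d * (e + g - 2 * f)"
    unfolding eqs s_def by (simp add: algebra_simps)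
  have "int d * (e + g - 2 * f) \<in> {- 2 * int d, - int d, 0, int d, 2 * int d}"
    using digits by auto
  then have "\<bar>int (d + N) * q\<bar> < int (d + N) * 2"
    unfolding q [symmetric] diff using s_bound d N by auto
  then have "int (d + N) * \<bar>q\<bar> < int (d + N) * 2"
    by (simp only: abs_mult abs_of_nat)
  then have "\<bar>q\<bar> < 2"
    by (rule mult_left_less_imp_less) simp
  then have "q \<in> {-1, 0, 1}" by auto
  then have cases: "s + int d * (e + g - 2 * f) \<in> {- int d - int N, 0, int d + int N}"
    using q diff by auto
  \<comment> \<open>For \<open>q = 0\<close>, a nonzero coefficient of \<open>d\<close> needs |s| at
    least \<open>d\<close>. For \<open>q\<close> = 1 or -1, coefficient \<open>q\<close> gives
    \<open>s = q N\<close>, and any other gives |s| at least \<open>d - N\<close>, beyond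
    \<open>2 M\<close>.\<close>
  have "e = f \<and> g = f \<and> s = 0"
    using digits cases s_bound s_ne d N by auto
  then show "x = y" "z = y"
    using eq_if eqs by simp_all
next
  note YD = modular_setD [OF Y]
  let ?Z = "Y \<union> (+) d ` Y"
  fix n
  assume n: "n < d + N" "n \<notin> ?Z"
  have sub: "x \<in> ?Z" "d + x \<in> ?Z" if "x \<in> Y" for x
    using that by auto
  have d_in: "d \<in> ?Z"
    using sub(2) [OF YD(2)] by simp
  consider "n < N" | "N \<le> n" "n < d" | "d \<le> n" by linarith
  then show "\<exists>y\<in>?Z. \<exists>z\<in>?Z. y < z \<and>
      (n + y = 2 * z \<or> n + (d + N) + y = 2 * z \<and> (\<exists>x\<in>?Z. n < x))"
  proof cases
    case 1
    then obtain y z where yz: "y \<in> Y" "z \<in> Y" "y < z" "n + y = 2 * z \<or> n + N + y = 2 * z"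
      using YD(5) [of n] n by blast
    show ?thesis
    proof (cases "n + y = 2 * z")
      case True
      then show ?thesis
        using yz sub by blast
    next
      case False
      then have "n + (d + N) + (d + y) = 2 * (d + z)" "d + y < d + z" "n < d"
        using yz 1 d by simp_all
      then show ?thesis
        using yz sub d_in by blast
    qed
  next
    case 2
    then obtain y z where yz: "y \<in> Y" "z \<in> Y" "int n + int N - int d = 2 * int z - int y"
      using full [of "int n + int N - int d"] by auto
    then have "int (n + (d + N) + y) = int (2 * (d + z))" by simp
    then have "n + (d + N) + y = 2 * (d + z)" by (simp only: of_nat_eq_iff)
    moreover have "y < d + z"
      using YD(3) [OF yz(1)] d by linarith
    ultimately show ?thesis
      using yz sub d_in 2 by blast
  next
    case 3
    then have "n - d \<notin> Y"
      using n(2) by (metis UnI2 image_eqI le_add_diff_inverse)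
    then obtain y z where yz: "y \<in> Y" "z \<in> Y" "y < z"
      "n - d + y = 2 * z \<or> n - d + N + y = 2 * z \<and> (\<exists>x\<in>Y. n - d < x)"
      using YD(5) [of "n - d"] 3 n(1) by fastforce
    show ?thesis
    proof (cases "n - d + y = 2 * z")
      case True
      then have "n + (d + y) = 2 * (d + z)" "d + y < d + z"
        using yz 3 by simp_all
      then show ?thesis
        using yz sub by blast
    next
      case False
      \<comment> \<open>The wraparound clause for \<open>Y\<close>, shifted by \<open>d\<close>,
        supplies the element above \<open>n\<close> that the new wraparound needs.\<close>
      then obtain x where "x \<in> Y" "n < d + x"
        using yz 3 by auto
      moreover have "n + (d + N) + y = 2 * (d + z)" "y < d + z"
        using yz False 3 by auto
      ultimately show ?thesis
        using yz sub by blast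
    qed
  qed
qed

lemma card_Un_shift:
  assumes "finite X" "\<And>x. x \<in> X \<Longrightarrow> x < (d::nat)"
  shows "card (X \<union> (+) d ` X) = 2 * card X"
proof -
  have "X \<inter> (+) d ` X = {}"
    using assms(2) by fastforce
  then show ?thesis
    using assms(1) by (simp add: card_Un_disjoint card_image)
qed

text \<open>This is \<open>k + 1\<close> triplings. Tripling a modulus \<open>P\<close> translates
  the differences \<open>2 z - y\<close> by -P, 0, P and 2 P, so their interval grows from
  \<open>[(3 N - P) / 2, P)\<close> to \<open>[(3 N - 3 P) / 2, 3 P)\<close>. Bounds are doubled to
  avoid fractions.\<close>

lemma modular_set_iterate:
  assumes X: "modular_set X N" and m: "\<And>x. x \<in> X \<Longrightarrow> x \<le> m"
  shows "\<exists>Y. modular_set Y (3 ^ Suc k * N) \<and> card Y = 2 ^ Suc k * card X \<and>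
    (\<forall>y\<in>Y. 2 * y + N \<le> 2 * m + 3 ^ Suc k * N) \<and>
    (\<forall>n::int. 3 * int N \<le> 2 * n + int (3 ^ Suc k * N) \<longrightarrow> n < int (3 ^ Suc k * N) \<longrightarrow>
      (\<exists>y\<in>Y. \<exists>z\<in>Y. n = 2 * int z - int y))"
proof (induction k)
  case 0
  note XD = modular_setD [OF X]
  let ?Y = "X \<union> (+) N ` X"
  have sub: "x \<in> ?Y" "N + x \<in> ?Y" if "x \<in> X" for x
    using that by auto
  have "\<exists>y\<in>?Y. \<exists>z\<in>?Y. n = 2 * int z - int y" if n: "0 \<le> n" "n < 3 * int N" for n
  proof -
    define i where "i = nat n"
    have i: "n = int i" "i < 3 * N"
      using n by (auto simp: i_def)
    have by_pair: ?thesis if "u \<in> ?Y" "v \<in> ?Y" "i + u = 2 * v" for u v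
    proof -
      have "n = 2 * int v - int u"
        using that(3) i by linarith
      then show ?thesis
        using that(1,2) by blast
    qed
    obtain r j where r: "r < N" "i = r + N * j"
      using i(2) by (intro that [of "i mod N" "i div N"]) auto
    have "N * j < N * 3"
      using i(2) r by linarith
    then have "j < 3"
      by (metis mult_less_cancel1)
    then consider "i = r" | "i = r + N" | "i = r + 2 * N"
      using r(2) by (auto simp: less_Suc_eq numeral_3_eq_3)
    note j_cases = this
    show ?thesis
    proof (cases "r \<in> X")
      \<comment> \<open>Unlike in \<open>modular_set\<close>, \<open>y = z\<close> is allowed, so
        elements of \<open>X\<close> represent themselves.\<close>
      case True
      then show ?thesis
        using j_cases by_pair [of r r] by_pair [of "N + r" "N + r"] by_pair [of r "N + r"] sub
        by (smt (verit) add.commute add.left_commute mult_2)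
    next
      case False
      then obtain y z where yz: "y \<in> X" "z \<in> X" "r + y = 2 * z \<or> r + N + y = 2 * z"
        using XD(5) r(1) by blast
      then show ?thesis
        using j_cases by_pair [of y z] by_pair [of "N + y" "N + z"] by_pair [of y "N + z"]
          by_pair [of "N + y" z] sub
        by (smt (verit) add.commute add.left_commute mult_2)
    qed
  qed
  moreover have "2 * y + N \<le> 2 * m + 3 * N" if "y \<in> ?Y" for y
    using that m by fastforce
  ultimately show ?case
    using modular_set_triple [OF X] card_Un_shift [OF XD(1,3)] by (intro exI [of _ ?Y]) auto
next
  case (Suc k)
  define P where "P = 3 ^ Suc k * N"
  have P3: "3 ^ Suc (Suc k) * N = 3 * P"
    by (simp add: P_def)
  obtain Y where Y: "modular_set Y P" "card Y = 2 ^ Suc k * card X"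
    and bound: "\<And>y. y \<in> Y \<Longrightarrow> 2 * y + N \<le> 2 * m + P"
    and full: "\<And>n::int. 3 * int N \<le> 2 * n + int P \<Longrightarrow> n < int P \<Longrightarrow>
      \<exists>y\<in>Y. \<exists>z\<in>Y. n = 2 * int z - int y"
    using Suc unfolding P_def by blast
  have "1 * N \<le> 3 ^ k * N"
    by (intro mult_le_mono1) simp
  \<comment> \<open>Hence the interval of the hypothesis contains \<open>[0, P)\<close>, and its
    translates leave no gap.\<close>
  then have PN: "3 * N \<le> P"
    by (simp add: P_def)
  let ?Z = "Y \<union> (+) P ` Y"
  have sub: "x \<in> ?Z" "P + x \<in> ?Z" if "x \<in> Y" for x
    using that by auto
  have "\<exists>y\<in>?Z. \<exists>z\<in>?Z. n = 2 * int z - int y"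
    if n: "3 * int N \<le> 2 * n + int (3 * P)" "n < int (3 * P)" for n
  proof -
    consider "n < 0" | "0 \<le> n" "n < int P" | "int P \<le> n" "n < 2 * int P" | "2 * int P \<le> n"
      by linarith
    then show ?thesis
    proof cases
      case 1
      then obtain y z where yz: "y \<in> Y" "z \<in> Y" "n + int P = 2 * int z - int y"
        using full [of "n + int P"] n by auto
      then have "n = 2 * int z - int (P + y)" by simp
      then show ?thesis
        using yz sub by blast
    next
      case 2
      then show ?thesis
        using full [of n] PN sub by fastforce
    next
      case 3
      then obtain y z where yz: "y \<in> Y" "z \<in> Y" "n - int P = 2 * int z - int y"
        using full [of "n - int P"] PN by auto
      then have "n = 2 * int (P + z) - int (P + y)" by simp
      then show ?thesis
        using yz sub by blast
    next
      case 4
      then obtain y z where yz: "y \<in> Y" "z \<in> Y" "n - 2 * int P = 2 * int z - int y"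
        using full [of "n - 2 * int P"] n PN by auto
      then have "n = 2 * int (P + z) - int y" by simp
      then show ?thesis
        using yz sub by blast
    qed
  qed
  moreover have "2 * y + N \<le> 2 * m + 3 * P" if "y \<in> ?Z" for y
    using that bound by fastforce
  moreover have "modular_set ?Z (3 * P)"
    using modular_set_triple [OF Y(1)] .
  moreover have "card ?Z = 2 ^ Suc (Suc k) * card X"
    using card_Un_shift [OF modular_setD(1,3) [OF Y(1)]] Y(2) by simp
  ultimately show ?case
    unfolding P3 by blast
qed

section \<open>Realizing every modulus between \<open>3 ^ \<kappa>\<close> and
  \<open>c 3 ^ \<kappa>\<close>\<close>

text \<open>
  The element \<open>a\<close> is the term with index \<open>2^(\<kappa> - 1)\<close>; \<open>3 a \<noteq> R\<close> makes \<open>\<kappa>\<close> minimal.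
\<close>

definition has_repeat_factor :: "nat \<Rightarrow> nat \<Rightarrow> bool" where
  "has_repeat_factor \<kappa> R \<longleftrightarrow>
    (\<exists>X. modular_set X R \<and> card X = 2 ^ \<kappa> \<and> (\<exists>a\<in>X. card {x \<in> X. x < a} = 2 ^ (\<kappa> - 1) \<and> 3 * a \<noteq> R))"

text \<open>The conditions on \<open>d\<close> are those of \<open>modular_set_shift\<close> for the
  modulus \<open>P\<close>: the second keeps the copies apart, given the bound on \<open>Y\<close>
  from \<open>modular_set_iterate\<close>, and the third puts \<open>2 P - d\<close> into the
  interval of differences. The exponent counts \<open>k + 1\<close> triplings and one shift.\<close>

lemma has_repeat_factor_shift:
  assumes X: "modular_set X N" "card X = 2 ^ j" "\<And>x. x \<in> X \<Longrightarrow> x \<le> m" "m < N"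
    and P: "P = 3 ^ Suc k * N"
    and d: "2 * P \<le> d" "2 * m + 2 * P < d + N" "2 * d + 3 * N \<le> 5 * P"
  shows "has_repeat_factor (j + k + 2) (d + P)"
proof -
  obtain Y where Y: "modular_set Y P" "card Y = 2 ^ Suc k * card X"
    and bound: "\<And>y. y \<in> Y \<Longrightarrow> 2 * y + N \<le> 2 * m + P"
    and full: "\<And>n::int. 3 * int N \<le> 2 * n + int P \<Longrightarrow> n < int P \<Longrightarrow>
      \<exists>y\<in>Y. \<exists>z\<in>Y. n = 2 * int z - int y"
    using modular_set_iterate [of X N m k, OF X(1,3)] unfolding P [symmetric] by blast
  note YD = modular_setD [OF Y(1)]
  let ?Z = "Y \<union> (+) d ` Y"
  have "1 * N \<le> 3 ^ k * N"
    by (intro mult_le_mono1) simp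
  then have PN: "3 * N \<le> P"
    by (simp add: P)
  define M where "M = (2 * m + P - N) div 2"
  have Y_less: "y < d" if "y \<in> Y" for y
    using YD(3) [OF that] d(1) by linarith
  have "modular_set ?Z (d + P)"
  proof (rule modular_set_shift)
    show "modular_set Y P" by fact
    show "y \<le> M" if "y \<in> Y" for y
      using bound [OF that] unfolding M_def by linarith
    show "2 * P \<le> d" by fact
    show "P + 2 * M < d" "M < P"
      using d PN X(4) unfolding M_def by linarith+
    show "\<exists>y\<in>Y. \<exists>z\<in>Y. n = 2 * int z - int y"
      if "2 * int P - int d \<le> n" "n < int P" for n
      using full [of n] that d(3) by linarith
  qed
  moreover have "card ?Z = 2 ^ (j + k + 2)"
    using card_Un_shift [OF YD(1) Y_less] Y(2) X(2) by (simp add: power_add)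
  moreover have "{x \<in> ?Z. x < d} = Y"
    using Y_less by auto
  then have "card {x \<in> ?Z. x < d} = 2 ^ (j + k + 2 - 1)"
    using Y(2) X(2) by (simp add: power_add)
  moreover have "d \<in> ?Z"
    using YD(2) by force
  moreover have "3 * d \<noteq> d + P"
    using d(1) PN X(4) by linarith
  ultimately show ?thesis
    unfolding has_repeat_factor_def by blast
qed

text \<open>Start from \<open>{0}\<close> with \<open>P = 3 ^ (\<kappa> - 1)\<close>. Then
  \<open>d = R - P\<close> is at most \<open>7 P / 3\<close>, and \<open>2 d + 3 \<le> 5 P\<close>
  follows once \<open>P \<ge> 9\<close>, hence \<open>3 \<le> \<kappa>\<close>.\<close>

lemma has_repeat_factor_near_power:
  assumes "3 \<le> \<kappa>" "3 ^ \<kappa> \<le> R" "9 * R \<le> 10 * 3 ^ \<kappa>"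
  shows "has_repeat_factor \<kappa> R"
proof -
  obtain k where k: "\<kappa> = k + 2" "k \<ge> 1"
    using assms(1) by (intro that [of "\<kappa> - 2"]) auto
  define P :: nat where "P = 3 ^ Suc k * 1"
  have "(3::nat) ^ 1 \<le> 3 ^ k"
    using k by (intro power_increasing) auto
  then have P: "9 \<le> P" "3 ^ \<kappa> = 3 * P"
    using k by (simp_all add: P_def)
  have "has_repeat_factor (0 + k + 2) (R - P + P)"
  proof (rule has_repeat_factor_shift [where X = "{0}" and m = 0 and N = 1 and P = P])
    show "modular_set {0} 1"
      by (simp add: modular_set_def)
  qed (use assms P P_def in auto)
  then show ?thesis
    using assms P k by simp
qed

text \<open>Take \<open>k = 1\<close>, \<open>P = 9 N\<close> and the trivial bound
  \<open>m = N - 1\<close>: the conditions on \<open>d = R - 9 N\<close> become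
  \<open>R > 28 N - 2\<close> and \<open>R \<le> 30 N\<close>. With \<open>k = 0\<close> nothing
  would be left once \<open>N \<ge> 2\<close>.\<close>

lemma has_repeat_factor_step:
  assumes "has_repeat_factor \<kappa> N" "28 * N \<le> R" "R \<le> 30 * N"
  shows "has_repeat_factor (\<kappa> + 3) R"
proof -
  obtain X where X: "modular_set X N" "card X = 2 ^ \<kappa>"
    using assms(1) unfolding has_repeat_factor_def by blast
  note XD = modular_setD [OF X(1)]
  have N: "N > 0"
    using XD(2,3) by blast
  have "has_repeat_factor (\<kappa> + 1 + 2) (R - 9 * N + 9 * N)"
  proof (rule has_repeat_factor_shift [where m = "N - 1"])
    show "x \<le> N - 1" if "x \<in> X" for x
      using XD(3) [OF that] by linarith
  qed (use assms X N in auto)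
  then show ?thesis
    using assms by (simp add: add.assoc numeral_3_eq_3)
qed

lemma has_repeat_factor_range:
  "\<exists>K. \<forall>\<kappa>\<ge>K. \<forall>R. 3 ^ \<kappa> \<le> R \<longrightarrow> real R \<le> (15 / 14) ^ n * 3 ^ \<kappa> \<longrightarrow> has_repeat_factor \<kappa> R"
proof (induction n)
  case 0
  have "has_repeat_factor \<kappa> R"
    if "3 \<le> \<kappa>" and R: "3 ^ \<kappa> \<le> R" "real R \<le> (15 / 14) ^ 0 * 3 ^ \<kappa>" for \<kappa> R
  proof -
    have "real R \<le> real (3 ^ \<kappa>)"
      using R(2) by simp
    then have "R \<le> 3 ^ \<kappa>"
      by (simp only: of_nat_le_iff)
    then show ?thesis
      using that by (intro has_repeat_factor_near_power) auto
  qed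
  then show ?case by blast
next
  case (Suc n)
  then obtain K where K: "\<And>\<kappa> R. K \<le> \<kappa> \<Longrightarrow> 3 ^ \<kappa> \<le> R \<Longrightarrow> real R \<le> (15 / 14) ^ n * 3 ^ \<kappa> \<Longrightarrow>
      has_repeat_factor \<kappa> R"
    by blast
  have "has_repeat_factor \<kappa> R"
    if \<kappa>: "K + 7 \<le> \<kappa>" and R: "3 ^ \<kappa> \<le> R" "real R \<le> (15 / 14) ^ Suc n * 3 ^ \<kappa>" for \<kappa> R
  proof (cases "9 * R \<le> 10 * 3 ^ \<kappa>")
    case True
    then show ?thesis
      using \<kappa> R by (intro has_repeat_factor_near_power) auto
  next
    \<comment> \<open>Since 10 / 9 = 30 / 27, now \<open>R / 30 > 3 ^ (\<kappa> - 3)\<close>, so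
      \<open>N\<close> below does not drop out of the range of the induction hypothesis.\<close>
    case False
    obtain l where l: "\<kappa> = l + 3" "K \<le> l"
      using \<kappa> by (intro that [of "\<kappa> - 3"]) auto
    have pow: "(3::nat) ^ \<kappa> = 27 * 3 ^ l"
      by (simp add: l power_add)
    \<comment> \<open>Rounding up to \<open>N\<close> costs at most 29 / 30, and
      \<open>405 N \<le> 14 R\<close> then needs \<open>R \<ge> 783\<close>; \<open>3 ^ 7\<close> is
      the first power of 3 beyond that.\<close>
    have "(3::nat) ^ 7 \<le> 3 ^ \<kappa>"
      using \<kappa> by (intro power_increasing) auto
    then have R_large: "2187 \<le> R"
      using R by simp
    \<comment> \<open>\<open>N = \<lceil>R / 30\<rceil>\<close> lies in the window \<open>[R / 30, R / 28]\<close> of the step and lowers \<open>R / 3^\<kappa>\<close> by a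
      factor at least \<open>15 / 14\<close>, since \<open>27 N \<le> 14 R / 15\<close>\<close>
    define N where "N = (R + 29) div 30"
    have N: "28 * N \<le> R" "R \<le> 30 * N" "405 * N \<le> 14 * R" "3 ^ l \<le> N"
      using R_large False unfolding N_def pow by linarith+
    have "405 * real N \<le> 14 * real R"
      using N(3) by (metis of_nat_le_iff of_nat_mult of_nat_numeral)
    also have "\<dots> \<le> 14 * ((15 / 14) ^ Suc n * (27 * 3 ^ l))"
      using R(2) unfolding l by (simp add: power_add mult.commute)
    finally have "real N \<le> (15 / 14) ^ n * 3 ^ l"
      by (simp add: mult.commute)
    then show ?thesis
      using has_repeat_factor_step [OF K] N l by simp
  qed
  then show ?case by blast
qed

section \<open>All large repeat factors and all triadic scaling factors\<close>

lemma has_repeat_factor_Stanley: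
  assumes "has_repeat_factor \<kappa> R"
  obtains A where "independent_stanley A" "stanley_kappa A = \<kappa>"
    "\<And>k. \<kappa> \<le> k \<Longrightarrow> stanley_seq A (2 ^ k) = R * 3 ^ (k - \<kappa>)"
proof -
  obtain X a where X: "modular_set X R" "card X = 2 ^ \<kappa>"
    and a: "a \<in> X" "card {x \<in> X. x < a} = 2 ^ (\<kappa> - 1)" "3 * a \<noteq> R"
    using assms unfolding has_repeat_factor_def by blast
  show thesis
    using independent_modular [OF X] stanley_kappa_modular [OF X a] stanley_seq_pow2 [OF X]
    by (intro that)
qed

lemma ex_repeat_factor:
  obtains K where "\<And>\<kappa> R. K \<le> \<kappa> \<Longrightarrow> 3 ^ \<kappa> \<le> R \<Longrightarrow> R \<le> c * 3 ^ \<kappa> \<Longrightarrow> has_repeat_factor \<kappa> R"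
proof -
  obtain n where n: "real c < (15 / 14) ^ n"
    using real_arch_pow [of "15 / 14" "real c"] by auto
  obtain K where K: "\<And>\<kappa> R. K \<le> \<kappa> \<Longrightarrow> 3 ^ \<kappa> \<le> R \<Longrightarrow> real R \<le> (15 / 14) ^ n * 3 ^ \<kappa> \<Longrightarrow>
      has_repeat_factor \<kappa> R"
    using has_repeat_factor_range by blast
  have "has_repeat_factor \<kappa> R" if "K \<le> \<kappa>" "3 ^ \<kappa> \<le> R" "R \<le> c * 3 ^ \<kappa>" for \<kappa> R
  proof -
    have "real R \<le> real c * 3 ^ \<kappa>"
      using that(3) by (metis of_nat_le_iff of_nat_mult of_nat_numeral of_nat_power)
    also have "\<dots> \<le> (15 / 14) ^ n * 3 ^ \<kappa>"
      using n by simp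
    finally show ?thesis
      using K that by blast
  qed
  then show thesis
    using that by blast
qed

lemma ex_independent_repeat_factor:
  "\<exists>M. \<forall>R\<ge>M. \<exists>A. independent_stanley A \<and> repeat_factor A = R"
proof -
  obtain K where K: "\<And>\<kappa> R. K \<le> \<kappa> \<Longrightarrow> 3 ^ \<kappa> \<le> R \<Longrightarrow> R \<le> 3 * 3 ^ \<kappa> \<Longrightarrow> has_repeat_factor \<kappa> R"
    using ex_repeat_factor [of 3] by blast
  have "\<exists>A. independent_stanley A \<and> repeat_factor A = R" if R: "3 ^ K \<le> R" for R
  proof -
    have "R \<ge> 1"
      using R by (metis le_trans one_le_numeral one_le_power)
    \<comment> \<open>The ratio \<open>R / 3 ^ \<kappa>\<close> is below 3, which explains the
      choice \<open>c = 3\<close> above.\<close>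
    then obtain \<kappa> where \<kappa>: "3 ^ \<kappa> \<le> R" "R < 3 ^ (\<kappa> + 1)"
      using ex_power_ivl1 [of 3 R] by auto
    have "(3::nat) ^ K < 3 ^ (\<kappa> + 1)"
      using R \<kappa> by linarith
    then have "K < \<kappa> + 1"
      by (rule power_less_imp_less_exp [rotated]) simp
    then have "has_repeat_factor \<kappa> R"
      using K \<kappa> by simp
    then obtain A where A: "independent_stanley A" "stanley_kappa A = \<kappa>"
      "\<And>k. \<kappa> \<le> k \<Longrightarrow> stanley_seq A (2 ^ k) = R * 3 ^ (k - \<kappa>)"
      by (rule has_repeat_factor_Stanley) blast
    then show ?thesis
      using A(3) [of \<kappa>] unfolding repeat_factor_def by auto
  qed
  then show ?thesis by blast
qed

lemma ex_independent_scaling_factor: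
  assumes "triadic \<alpha>" "\<alpha> \<ge> 1"
  shows "\<exists>A. independent_stanley A \<and> scaling_factor A = \<alpha>"
proof -
  obtain j where "snd (quotient_of \<alpha>) = 3 ^ j"
    using assms(1) unfolding triadic_def by blast
  then obtain i where "quotient_of \<alpha> = (i, 3 ^ j)"
    by (metis prod.collapse)
  then have "\<alpha> = rat_of_int i / 3 ^ j"
    using quotient_of_div by fastforce
  moreover from this have "i > 0"
    using assms(2) by (metis divide_nonpos_pos linorder_not_le of_int_le_0_iff order.strict_trans2
        zero_less_numeral zero_less_one zero_less_power not_le)
  ultimately obtain p where \<alpha>: "\<alpha> = of_nat p / 3 ^ j"
    by (metis of_int_of_nat_eq zero_less_imp_eq_int)
  then have "rat_of_nat (3 ^ j) \<le> of_nat p"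
    using assms(2) by (simp add: le_divide_eq_1)
  then have p: "3 ^ j \<le> p"
    by (simp only: of_nat_le_iff)
  obtain K where K: "\<And>\<kappa> R. K \<le> \<kappa> \<Longrightarrow> 3 ^ \<kappa> \<le> R \<Longrightarrow> R \<le> p * 3 ^ \<kappa> \<Longrightarrow> has_repeat_factor \<kappa> R"
    using ex_repeat_factor [of p] by blast
  \<comment> \<open>Expanding \<alpha> = \<open>p / 3 ^ j\<close> by \<open>3 ^ K\<close> makes the
    exponent large enough and keeps the ratio; \<alpha> \<ge> 1 is the lower bound on the
    modulus.\<close>
  have "has_repeat_factor (K + j) (p * 3 ^ K)"
  proof (rule K)
    show "3 ^ (K + j) \<le> p * 3 ^ K"
      using p by (simp add: power_add mult.commute)
    show "p * 3 ^ K \<le> p * 3 ^ (K + j)"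
      by (intro mult_le_mono2 power_increasing) auto
  qed simp
  then obtain A where A: "independent_stanley A" "stanley_kappa A = K + j"
    "\<And>k. K + j \<le> k \<Longrightarrow> stanley_seq A (2 ^ k) = p * 3 ^ K * 3 ^ (k - (K + j))"
    by (rule has_repeat_factor_Stanley) blast
  have "scaling_factor A = \<alpha>"
  proof (rule scaling_factorI)
    show "\<alpha> > 0"
      using assms(2) by simp
    fix k
    assume "stanley_kappa A \<le> k"
    then obtain h where h: "k = K + j + h"
      using A(2) le_Suc_ex by auto
    show "of_nat (stanley_seq A (2 ^ k)) = \<alpha> * 3 ^ k"
      using A(3) [of k] unfolding h \<alpha> by (simp add: power_add field_simps)
  qed
  then show ?thesis
    using A(1) by blast
qed

theorem theorem2p3:
  shows "(\<exists>M::int. \<forall>\<rho>::int. \<rho> \<ge> M \<longrightarrow>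
            (\<exists>A. independent_stanley A \<and> int (repeat_factor A) = \<rho>)) \<and>
         (\<forall>\<alpha>::rat. triadic \<alpha> \<and> \<alpha> \<ge> 1 \<longrightarrow>
            (\<exists>A. independent_stanley A \<and> scaling_factor A = \<alpha>))"
proof -
  obtain M where M: "\<And>R. M \<le> R \<Longrightarrow> \<exists>A. independent_stanley A \<and> repeat_factor A = R"
    using ex_independent_repeat_factor by blast
  have "\<exists>A. independent_stanley A \<and> int (repeat_factor A) = \<rho>" if "int M \<le> \<rho>" for \<rho>
    using M [of "nat \<rho>"] that by fastforce
  then show ?thesis
    using ex_independent_scaling_factor by blast
qed

end
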